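(* Let $X$ be a real Hilbert space and let $A$ and $B$ be maximally monotone operators on $X$. Then $$v(A,B)=v\big((-\operatorname{Id})\circ A^{-1}\circ(-\operatorname{Id}),B^{-1}\big),$$ where $v(\cdot,\cdot)$ denotes the infimal displacement vector of a pair. Moreover, perturbing by $v:=v(A,B)$ and taking the Attouch–Théra dual commute up to a shift: with the operators $C\colon x\mapsto \big((-\operatorname{Id})\circ A^{-1}\circ(-\operatorname{Id})\big)(x-v)+B^{-1}x-v$ (the sum of the $v$-perturbation of the dual pair) and $D\colon x\mapsto \big((-\operatorname{Id})\circ A^{-1}\circ(-\operatorname{Id})\big)x-v+B^{-1}(x+v)$ (the sum of the dual of the $v$-perturbed pair), one has $\operatorname{gra}C=(v,0)+\operatorname{gra}D$.
   Context: Operators on $X$ may be set-valued. For an operator $A$, $(-\operatorname{Id})\circ A^{-1}\circ(-\operatorname{Id})=\big((-\operatorname{Id})\circ A\circ(-\operatorname{Id})\big)^{-1}$. The Attouch–Théra dual pair of $(A,B)$ is $(A,B)^*=\big((-\operatorname{Id})\circ A^{-1}\circ(-\operatorname{Id}),B^{-1}\big)$. The $w$-perturbation of $(A,B)$ is the pair $(x\mapsto A(x-w),\;x\mapsto Bx-w)$. The resolvent of a maximally monotone operator $A$ is $J_A=(\operatorname{Id}+A)^{-1}$, and $R_A=2J_A-\operatorname{Id}$. The Douglas–Rachford splitting operator of $(A,B)$ is $T_{(A,B)}=J_AR_B+\operatorname{Id}-J_B$; it is firmly nonexpansive, hence $\overline{\operatorname{ran}}(\operatorname{Id}-T_{(A,B)})$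 is nonempty, closed and convex. The infimal displacement vector is $v(A,B)=P_{\overline{\operatorname{ran}}(\operatorname{Id}-T_{(A,B)})}0$, the element of minimal norm of this set. *)

theory Defs
  imports "HOL-Analysis.Analysis" "HOL-Library.Set_Algebras"
begin

text \<open>
  Operators on a real Hilbert space (type class \<open>real_inner\<close> together with \<open>complete_space\<close>)
  are set-valued, that is, functions of type \<open>'a \<Rightarrow> 'a set\<close>; \<open>x\<close> lies in the domain
  of \<open>A\<close> iff \<open>A x\<close> is nonempty.
\<close>

type_synonym 'a operator = "'a \<Rightarrow> 'a set"

definition gra :: "'a operator \<Rightarrow> ('a \<times> 'a) set" where
  "gra A = {(x, u). u \<in> A x}"

definition ran :: "'a operator \<Rightarrow> 'a set" where
  "ran A = (\<Union>x. A x)"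

definition monotone_operator :: "'a::real_inner operator \<Rightarrow> bool" where
  "monotone_operator A \<longleftrightarrow>
    (\<forall>(x, u) \<in> gra A. \<forall>(y, v) \<in> gra A. 0 \<le> inner (x - y) (u - v))"

definition maximally_monotone :: "'a::real_inner operator \<Rightarrow> bool" where
  "maximally_monotone A \<longleftrightarrow>
    monotone_operator A \<and>
    (\<forall>B. monotone_operator B \<and> gra A \<subseteq> gra B \<longrightarrow> gra B = gra A)"

definition op_inverse :: "'a operator \<Rightarrow> 'a operator" where
  "op_inverse A = (\<lambda>u. {x. u \<in> A x})"

definition op_compose :: "'a operator \<Rightarrow> 'a operator \<Rightarrow> 'a operator" where
  "op_compose A B = (\<lambda>x. \<Union>y \<in> B x. A y)"

text \<open>Pointwise Minkowski sum; the \<open>+\<close> on sets is the one of \<open>Set_Algebras\<close>.\<close>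

definition op_add :: "'a::plus operator \<Rightarrow> 'a operator \<Rightarrow> 'a operator" where
  "op_add A B = (\<lambda>x. A x + B x)"

text \<open>Pointwise Minkowski difference; note that \<open>-\<close> on sets is the set difference.\<close>

definition op_diff :: "'a::minus operator \<Rightarrow> 'a operator \<Rightarrow> 'a operator" where
  "op_diff A B = (\<lambda>x. {a - b | a b. a \<in> A x \<and> b \<in> B x})"

definition op_scale :: "real \<Rightarrow> 'a::real_vector operator \<Rightarrow> 'a operator" where
  "op_scale c A = (\<lambda>x. (\<lambda>u. c *\<^sub>R u) ` A x)"

definition Id_op :: "'a operator" where
  "Id_op = (\<lambda>x. {x})"

text \<open>\<open>neg_conj A\<close> is $(-\mathrm{Id}) \circ A \circ (-\mathrm{Id})$.\<close>

definition neg_conj :: "'a::uminus operator \<Rightarrow> 'a operator" where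
  "neg_conj A = op_compose (\<lambda>x. {- x}) (op_compose A (\<lambda>x. {- x}))"

definition attouch_thera_dual ::
    "'a::uminus operator \<times> 'a operator \<Rightarrow> 'a operator \<times> 'a operator" where
  "attouch_thera_dual = (\<lambda>(A, B). (neg_conj (op_inverse A), op_inverse B))"

definition perturbation ::
    "'a::minus \<Rightarrow> 'a operator \<times> 'a operator \<Rightarrow> 'a operator \<times> 'a operator" where
  "perturbation w = (\<lambda>(A, B). (\<lambda>x. A (x - w), \<lambda>x. (\<lambda>u. u - w) ` B x))"

definition pair_sum :: "'a::plus operator \<times> 'a operator \<Rightarrow> 'a operator" where
  "pair_sum = (\<lambda>(A, B). op_add A B)"

text \<open>
  The resolvent, the reflected resolvent and the Douglas--Rachford operator are built by the
  set-valued calculus above. For maximally monotone operators all their values are singletons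
  (Minty), and the calculus is then the usual one for single-valued maps.
\<close>

definition resolvent :: "'a::plus operator \<Rightarrow> 'a operator" where
  "resolvent A = op_inverse (op_add Id_op A)"

definition reflected_resolvent :: "'a::real_vector operator \<Rightarrow> 'a operator" where
  "reflected_resolvent A = op_diff (op_scale 2 (resolvent A)) Id_op"

definition DR_operator :: "'a::real_vector operator \<times> 'a operator \<Rightarrow> 'a operator" where
  "DR_operator = (\<lambda>(A, B).
    op_diff (op_add (op_compose (resolvent A) (reflected_resolvent B)) Id_op) (resolvent B))"

text \<open>
  The library's \<open>closest_point\<close> is restricted to \<open>heine_borel\<close>, i.e. to finite dimension.
  On a nonempty closed convex subset of a Hilbert space the nearest point exists and is unique.
\<close>

definition projection :: "'a::metric_space set \<Rightarrow> 'a \<Rightarrow> 'a" where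
  "projection C x = (THE p. p \<in> C \<and> (\<forall>y \<in> C. dist x p \<le> dist x y))"

definition inf_displacement :: "'a::real_inner operator \<times> 'a operator \<Rightarrow> 'a" where
  "inf_displacement P = projection (closure (ran (op_diff Id_op (DR_operator P)))) 0"

end

theory Submission
  imports Defs
begin

text \<open>
  The infimal displacement vector of a pair depends on the pair only through its
  Douglas--Rachford operator, so its invariance under duality follows from the self-duality
  $T_{(A,B)^*} = T_{(A,B)}$ (\<open>DR_operator_dual\<close>).  Self-duality rests on the inverse
  resolvent identity $J_{B^{-1}} = \mathrm{Id} - J_B$: it gives $R_{B^{-1}} = -R_B$ and, for
  $A' = (-\mathrm{Id}) \circ A^{-1} \circ (-\mathrm{Id})$, also
  $J_{A'}(-y) = J_A y - y$.  Hence
  \[ T_{(A',B^{-1})} x = (J_A R_B x - R_B x) + x - (x - J_B x)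
      = J_A R_B x + x - J_B x = T_{(A,B)} x . \]
  The last cancellation, $2 J_B x - J_B x = J_B x$, mixes several occurrences of $J_B x$; it
  is legitimate in the set-valued calculus because the resolvent of a monotone operator has at
  most one value at each point.  Where $J_B x$ is empty, both operators are empty at $x$.

  In the second part, inversion turns a translation of the argument into a translation of the
  value and vice versa.  Both sums then consist of the same summands, with the vector $-v$
  attached to the second one in $C$ and to the first one in $D$, and with arguments that
  differ by $v$.
\<close>

section \<open>Elementwise form of the operator calculus\<close>

lemma mem_neg_conj_op_inverse:
  fixes A :: "'a::group_add operator"
  shows "u \<in> neg_conj (op_inverse A) x \<longleftrightarrow> - x \<in> A (- u)"
  by (force simp: neg_conj_def op_compose_def op_inverse_def)

lemma mem_resolvent:
  fixes A :: "'a::ab_group_add operator"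
  shows "p \<in> resolvent A x \<longleftrightarrow> x - p \<in> A p"
proof -
  have "p \<in> resolvent A x \<longleftrightarrow> (\<exists>u \<in> A p. x = p + u)"
    by (simp add: resolvent_def op_inverse_def op_add_def Id_op_def set_plus_def)
  also have "\<dots> \<longleftrightarrow> (\<exists>u \<in> A p. u = x - p)"
    by (metis add_diff_cancel_left' diff_add_cancel add.commute)
  finally show ?thesis by blast
qed

lemma mem_DR_operator:
  fixes A B :: "'a::real_vector operator"
  shows "t \<in> DR_operator (A, B) x \<longleftrightarrow>
    (\<exists>p p' q. p \<in> resolvent B x \<and> p' \<in> resolvent B x \<and>
      q \<in> resolvent A (2 *\<^sub>R p - x) \<and> t = q + x - p')"
  unfolding DR_operator_def reflected_resolvent_def op_diff_def op_add_def op_compose_def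
    op_scale_def Id_op_def set_plus_def
  by (simp; blast)

section \<open>Self-duality of the Douglas--Rachford operator\<close>

text \<open>
  If $p, q \in J_A x$, then monotonicity applied to $x - p \in A p$ and $x - q \in A q$ gives
  $0 \le \langle p - q, q - p \rangle = -\|p - q\|^2$.
\<close>

lemma resolvent_unique:
  fixes A :: "'a::real_inner operator"
  assumes "monotone_operator A" and "p \<in> resolvent A x" and "q \<in> resolvent A x"
  shows "p = q"
proof -
  have "0 \<le> inner (p - q) ((x - p) - (x - q))"
    using assms unfolding monotone_operator_def gra_def mem_resolvent by blast
  also have "(x - p) - (x - q) = - (p - q)" by simp
  finally have "inner (p - q) (p - q) \<le> 0" by (simp only: inner_minus_right neg_0_le_iff_le)
  then show ?thesis by (metis inner_gt_zero_iff linorder_not_less right_minus_eq)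
qed

text \<open>The inverse resolvent identity $J_{B^{-1}} = \mathrm{Id} - J_B$.\<close>

lemma mem_resolvent_op_inverse:
  fixes B :: "'a::ab_group_add operator"
  shows "p \<in> resolvent (op_inverse B) x \<longleftrightarrow> x - p \<in> resolvent B x"
  by (simp add: mem_resolvent op_inverse_def)

lemma mem_resolvent_neg_conj_op_inverse:
  fixes A :: "'a::ab_group_add operator"
  shows "q \<in> resolvent (neg_conj (op_inverse A)) y \<longleftrightarrow> q - y \<in> resolvent A (- y)"
  by (simp add: mem_resolvent mem_neg_conj_op_inverse)

theorem DR_operator_dual:
  fixes A B :: "'a::real_inner operator"
  assumes "monotone_operator B"
  shows "DR_operator (neg_conj (op_inverse A), op_inverse B) = DR_operator (A, B)"
proof (intro ext set_eqI)
  fix x t :: 'a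
  note unique = resolvent_unique[OF assms]
  have reflected: "2 *\<^sub>R (x - p) - x = - (2 *\<^sub>R p - x)" for p
    by (simp add: algebra_simps scaleR_2)
  show "t \<in> DR_operator (neg_conj (op_inverse A), op_inverse B) x \<longleftrightarrow>
      t \<in> DR_operator (A, B) x" (is "?L \<longleftrightarrow> ?R")
  proof
    assume ?L
    then obtain p p' q where
      p: "x - p \<in> resolvent B x" "x - p' \<in> resolvent B x" and
      q: "q - (2 *\<^sub>R p - x) \<in> resolvent A (- (2 *\<^sub>R p - x))" and t: "t = q + x - p'"
      unfolding mem_DR_operator mem_resolvent_op_inverse mem_resolvent_neg_conj_op_inverse
      by blast
    have "p' = p" using unique[OF p] by simp
    then have "t = (q - (2 *\<^sub>R p - x)) + x - (x - p)"
      using t by (simp add: algebra_simps scaleR_2)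
    moreover have "q - (2 *\<^sub>R p - x) \<in> resolvent A (2 *\<^sub>R (x - p) - x)"
      using q unfolding reflected .
    ultimately show ?R
      unfolding mem_DR_operator using p(1) by blast
  next
    assume ?R
    then obtain p p' q where
      p: "p \<in> resolvent B x" "p' \<in> resolvent B x" and
      q: "q \<in> resolvent A (2 *\<^sub>R p - x)" and t: "t = q + x - p'"
      unfolding mem_DR_operator by blast
    have p': "p' = p" using unique[OF p] by simp
    define q' where "q' = q + (2 *\<^sub>R (x - p) - x)"
    have "t = q' + x - (x - p)"
      unfolding t p' q'_def by (simp add: algebra_simps scaleR_2)
    moreover have "x - p \<in> resolvent (op_inverse B) x"
      using p(1) by (simp add: mem_resolvent_op_inverse)
    moreover have "q' \<in> resolvent (neg_conj (op_inverse A)) (2 *\<^sub>R (x - p) - x)"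
      using q unfolding mem_resolvent_neg_conj_op_inverse q'_def reflected by simp
    ultimately show ?L
      unfolding mem_DR_operator by blast
  qed
qed

section \<open>Perturbation and duality\<close>

text \<open>
  The dual of a perturbed pair: shifting the argument of $A$ by $w$ shifts the values of
  $A^{-1}$ by $w$, which the conjugation with $-\mathrm{Id}$ turns into $-w$; subtracting $w$
  from the values of $B$ moves the argument of $B^{-1}$ by $w$.
\<close>

lemma attouch_thera_dual_perturbation:
  fixes A B :: "'a::ab_group_add operator"
  shows "attouch_thera_dual (perturbation w (A, B)) =
    (\<lambda>x. (\<lambda>u. u - w) ` neg_conj (op_inverse A) x, \<lambda>x. op_inverse B (x + w))"
proof -
  have "neg_conj (op_inverse (\<lambda>x. A (x - w))) x =
      (\<lambda>u. u - w) ` neg_conj (op_inverse A) x" for x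
  proof (rule set_eqI)
    fix u
    have "u \<in> neg_conj (op_inverse (\<lambda>x. A (x - w))) x \<longleftrightarrow>
        u + w \<in> neg_conj (op_inverse A) x"
      by (simp add: mem_neg_conj_op_inverse)
    also have "\<dots> \<longleftrightarrow> u \<in> (\<lambda>u. u - w) ` neg_conj (op_inverse A) x"
      by (force simp: image_iff)
    finally show "u \<in> neg_conj (op_inverse (\<lambda>x. A (x - w))) x \<longleftrightarrow>
        u \<in> (\<lambda>u. u - w) ` neg_conj (op_inverse A) x" .
  qed
  moreover have "op_inverse (\<lambda>x. (\<lambda>u. u - w) ` B x) x = op_inverse B (x + w)" for x
    by (force simp: op_inverse_def image_iff)
  ultimately show ?thesis
    by (auto simp: attouch_thera_dual_def perturbation_def fun_eq_iff)
qed

lemma set_plus_translate_commute: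
  fixes S T :: "'a::ab_group_add set"
  shows "S + (\<lambda>u. u - w) ` T = (\<lambda>u. u - w) ` S + T"
proof -
  have "(\<exists>a\<in>S. \<exists>b\<in>T. x = a + (b - w)) \<longleftrightarrow> (\<exists>a\<in>S. \<exists>b\<in>T. x = (a - w) + b)" for x
    by (simp add: algebra_simps)
  then show ?thesis by (auto simp: set_plus_def)
qed

lemma gra_translate:
  fixes D :: "'a::ab_group_add operator"
  shows "gra (\<lambda>x. D (x - w)) = (\<lambda>z. (w, 0) + z) ` gra D"
proof -
  have "(x, u) \<in> (\<lambda>z. (w, 0) + z) ` gra D \<longleftrightarrow> u \<in> D (x - w)" for x u
    by (force simp: gra_def image_iff)
  then show ?thesis by (auto simp: gra_def)
qed

section \<open>Duality of the infimal displacement vector\<close>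

theorem mainTheorem4:
  fixes A B :: "'a::{real_inner, complete_space} operator"
  assumes "maximally_monotone A" and "maximally_monotone B"
  shows "inf_displacement (A, B) = inf_displacement (neg_conj (op_inverse A), op_inverse B) \<and>
    (let v = inf_displacement (A, B);
         C = (\<lambda>x. neg_conj (op_inverse A) (x - v) + (\<lambda>u. u - v) ` op_inverse B x);
         D = (\<lambda>x. (\<lambda>u. u - v) ` neg_conj (op_inverse A) x + op_inverse B (x + v))
     in C = pair_sum (perturbation v (attouch_thera_dual (A, B))) \<and>
        D = pair_sum (attouch_thera_dual (perturbation v (A, B))) \<and>
        gra C = (\<lambda>z. (v, 0) + z) ` gra D)"
proof -
  have "monotone_operator B"
    using assms(2) by (simp add: maximally_monotone_def)
  then have displacement:
    "inf_displacement (A, B) = inf_displacement (neg_conj (op_inverse A), op_inverse B)"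
    by (simp add: inf_displacement_def DR_operator_dual)
  define v where "v = inf_displacement (A, B)"
  let ?C = "\<lambda>x. neg_conj (op_inverse A) (x - v) + (\<lambda>u. u - v) ` op_inverse B x"
  let ?D = "\<lambda>x. (\<lambda>u. u - v) ` neg_conj (op_inverse A) x + op_inverse B (x + v)"
  have "?C = pair_sum (perturbation v (attouch_thera_dual (A, B)))"
    by (simp add: pair_sum_def perturbation_def attouch_thera_dual_def op_add_def)
  moreover have "?D = pair_sum (attouch_thera_dual (perturbation v (A, B)))"
    by (simp add: attouch_thera_dual_perturbation pair_sum_def op_add_def)
  moreover have "gra ?C = (\<lambda>z. (v, 0) + z) ` gra ?D"
  proof -
    have "?C = (\<lambda>x. ?D (x - v))"
      by (simp add: set_plus_translate_commute)
    then show ?thesis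
      using gra_translate[of ?D v] by simp
  qed
  ultimately show ?thesis
    using displacement unfolding Let_def v_def by blast
qed

end
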